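(* Let $(\mathfrak g,\mathfrak a,H)$ and $(\mathfrak g^\vee,\mathfrak a^\vee,H^\vee)$ be dual (admissible) triples, and let $\varphi:\mathfrak g\oplus\mathfrak g^*\to\mathfrak g^\vee\oplus\mathfrak g^{\vee*}$ be the isomorphism associated with the duality 2-form $F$ (see context). If $J$ is a generalized complex structure on $(\mathfrak g,H)$, then $$\tilde J:=\varphi\circ J\circ\varphi^{-1}$$ is a generalized complex structure on $(\mathfrak g^\vee,H^\vee)$.
   Context: Lie algebras are real and finite-dimensional; $d$ is the Chevalley–Eilenberg differential, with $d\eta(x,y)=-\eta([x,y])$ for $\eta\in\mathfrak g^*$. For a Lie algebra $\mathfrak g$ with a closed 3-form $H\in\Lambda^3\mathfrak g^*$, the Courant bracket on $\mathfrak g\oplus\mathfrak g^*$ is $[X+\xi,Y+\eta]_H=[X,Y]+i_Xd\eta-i_Yd\xi+i_Xi_YH$ (with $(i_Xi_YH)(Z)=H(Y,X,Z)$), and the canonical bilinear form is $\langle X+\xi,Y+\eta\rangle=\frac12(\eta(X)+\xi(Y))$. An (invariant) generalized complex structure on $(\mathfrak g,H)$ is a linear map $J:\mathfrak g\oplus\mathfrak g^*\to\mathfrak g\oplus\mathfrak g^*$ with $J^2=-1$, preserving $\langle\cdot,\cdot\rangle$, and whose $i$-eigenspace (in the complexification) is involutive under the ($\mathbb C$-bilinearly extended) Courant bracket $[\cdot,\cdot]_H$. Admissible triple. $(\mathfrak g,\mathfrak a,H)$ is admissible if $\mathfrak a$ is an abelian ideal of $\mathfrak g$, $H\in\Lambda^3\mathfrak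 g^*$ is closed, and $H(x,y,\cdot)=0$ for all $x,y\in\mathfrak a$. Dual triples. Let $(\mathfrak g,\mathfrak a,H)$ and $(\mathfrak g^\vee,\mathfrak a^\vee,H^\vee)$ be admissible triples with $\mathfrak g/\mathfrak a\simeq\mathfrak n\simeq\mathfrak g^\vee/\mathfrak a^\vee$, with quotient maps $q:\mathfrak g\to\mathfrak n$, $q^\vee:\mathfrak g^\vee\to\mathfrak n$. Let $\mathfrak c=\{(x,y)\in\mathfrak g\oplus\mathfrak g^\vee: q(x)=q^\vee(y)\}$, a Lie subalgebra of $\mathfrak g\oplus\mathfrak g^\vee$, with projections $p:\mathfrak c\to\mathfrak g$, $p^\vee:\mathfrak c\to\mathfrak g^\vee$, and let $\mathfrak k=\{(x,0):x\in\mathfrak a\}$, $\mathfrak k^\vee=\{(0,y):y\in\mathfrak a^\vee\}$. A 2-form $F\in\Lambda^2\mathfrak c^*$ is non-degenerate in the fibers if its restriction $F:\mathfrak k\times\mathfrak k^\vee\to\mathbb R$ is a non-degenerate pairing (in particular $\dim\mathfrak a=\dim\mathfrak a^\vee$). The two triples are dual if $\mathfrak g/\mathfrak a\simeq\mathfrak n\simeq\mathfrak g^\vee/\mathfrak a^\vee$ and there is a 2-form $F\in\Lambda^2\mathfrak c^*$, non-degenerate in the fibers, with $p^*H-p^{\vee*}H^\vee=dF$. The isomorphism $\varphi$. Fix such an $F$. For $x\in\mathfrak g$, $\xi\in\mathfrak g^*$ there is a unique $u_x\in\mathfrak c$ (depending on $x$ and $\xi$) with $p(u_x)=x$ and such that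 $p^*\xi-F(u_x,\cdot)$ vanishes on $\mathfrak k$; then there is a unique $\sigma_\xi\in\mathfrak g^{\vee*}$ with $p^*\xi-F(u_x,\cdot)=p^{\vee*}\sigma_\xi$. Define $\varphi(x+\xi)=p^\vee(u_x)+\sigma_\xi$. *)

theory Defs
  imports "HOL-Analysis.Analysis"
begin

section \<open>The dual of a real vector space\<close>

typedef (overloaded) 'v dual = "{f :: 'v::real_vector \<Rightarrow> real. linear f}"
  morphisms ev Abs_dual
  by (rule exI[of _ "\<lambda>_. 0"]) (simp add: module_hom_zero)

setup_lifting type_definition_dual

instantiation dual :: (real_vector) real_vector
begin

lift_definition zero_dual :: "'a dual" is "\<lambda>_. 0"
  by (simp add: module_hom_zero)

lift_definition plus_dual :: "'a dual \<Rightarrow> 'a dual \<Rightarrow> 'a dual" is "\<lambda>f g x. f x + g x"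
  by (simp add: linear_compose_add)

lift_definition minus_dual :: "'a dual \<Rightarrow> 'a dual \<Rightarrow> 'a dual" is "\<lambda>f g x. f x - g x"
  by (simp add: linear_compose_sub)

lift_definition uminus_dual :: "'a dual \<Rightarrow> 'a dual" is "\<lambda>f x. - f x"
  by (simp add: linear_compose_neg)

lift_definition scaleR_dual :: "real \<Rightarrow> 'a dual \<Rightarrow> 'a dual" is "\<lambda>c f x. c *\<^sub>R f x"
  by (rule linear_compose_scale_right)

instance
  by standard (transfer; simp add: fun_eq_iff algebra_simps)+

end

section \<open>Lie algebras and invariant forms\<close>

definition lie_algebra :: "('g::real_vector \<Rightarrow> 'g \<Rightarrow> 'g) \<Rightarrow> bool" where
  "lie_algebra br \<longleftrightarrow>
     (\<exists>B :: 'g set. finite B \<and> span B = UNIV) \<and>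
     bilinear br \<and>
     (\<forall>x. br x x = 0) \<and>
     (\<forall>x y z. br x (br y z) + br y (br z x) + br z (br x y) = 0)"

definition abelian_ideal :: "('g::real_vector \<Rightarrow> 'g \<Rightarrow> 'g) \<Rightarrow> 'g set \<Rightarrow> bool" where
  "abelian_ideal br A \<longleftrightarrow>
     subspace A \<and> (\<forall>x. \<forall>y\<in>A. br x y \<in> A) \<and> (\<forall>x\<in>A. \<forall>y\<in>A. br x y = 0)"

text \<open>
  A form on a subspace \<open>V\<close> is a function on the ambient type of which only the values on
  \<open>V\<close> matter.
\<close>

definition linear_form_on :: "'v::real_vector set \<Rightarrow> ('v \<Rightarrow> real) \<Rightarrow> bool" where
  "linear_form_on V f \<longleftrightarrow>
     (\<forall>x\<in>V. \<forall>y\<in>V. f (x + y) = f x + f y) \<and> (\<forall>c. \<forall>x\<in>V. f (c *\<^sub>R x) = c * f x)"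

definition two_form_on :: "'v::real_vector set \<Rightarrow> ('v \<Rightarrow> 'v \<Rightarrow> real) \<Rightarrow> bool" where
  "two_form_on V F \<longleftrightarrow>
     (\<forall>x\<in>V. linear_form_on V (\<lambda>y. F x y)) \<and>
     (\<forall>y\<in>V. linear_form_on V (\<lambda>x. F x y)) \<and>
     (\<forall>x\<in>V. F x x = 0)"

definition three_form :: "('v::real_vector \<Rightarrow> 'v \<Rightarrow> 'v \<Rightarrow> real) \<Rightarrow> bool" where
  "three_form H \<longleftrightarrow>
     (\<forall>y z. linear (\<lambda>x. H x y z)) \<and> (\<forall>x z. linear (\<lambda>y. H x y z)) \<and> (\<forall>x y. linear (\<lambda>z. H x y z)) \<and>
     (\<forall>x y. H x x y = 0 \<and> H x y x = 0 \<and> H y x x = 0)"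

text \<open>
  The Chevalley--Eilenberg differential in degrees one, two and three:
  \<open>d\<omega>(x\<^sub>0,\<dots>,x\<^sub>k) = \<Sum>i<j. (-1)^(i+j) \<omega>([x\<^sub>i,x\<^sub>j],x\<^sub>0,\<dots>,x\<^sub>k)\<close>, with \<open>x\<^sub>i\<close> and \<open>x\<^sub>j\<close> omitted
  from the list after the bracket.
\<close>

definition ce_d1 :: "('v \<Rightarrow> 'v \<Rightarrow> 'v) \<Rightarrow> ('v \<Rightarrow> real) \<Rightarrow> 'v \<Rightarrow> 'v \<Rightarrow> real" where
  "ce_d1 br f x y = - f (br x y)"

definition ce_d2 :: "('v \<Rightarrow> 'v \<Rightarrow> 'v) \<Rightarrow> ('v \<Rightarrow> 'v \<Rightarrow> real) \<Rightarrow> 'v \<Rightarrow> 'v \<Rightarrow> 'v \<Rightarrow> real" where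
  "ce_d2 br F x y z = - F (br x y) z + F (br x z) y - F (br y z) x"

definition ce_d3 ::
  "('v \<Rightarrow> 'v \<Rightarrow> 'v) \<Rightarrow> ('v \<Rightarrow> 'v \<Rightarrow> 'v \<Rightarrow> real) \<Rightarrow> 'v \<Rightarrow> 'v \<Rightarrow> 'v \<Rightarrow> 'v \<Rightarrow> real" where
  "ce_d3 br H x y z w =
     - H (br x y) z w + H (br x z) y w - H (br x w) y z
     - H (br y z) x w + H (br y w) x z - H (br z w) x y"

definition closed_three_form ::
  "('g::real_vector \<Rightarrow> 'g \<Rightarrow> 'g) \<Rightarrow> ('g \<Rightarrow> 'g \<Rightarrow> 'g \<Rightarrow> real) \<Rightarrow> bool" where
  "closed_three_form br H \<longleftrightarrow> three_form H \<and> (\<forall>x y z w. ce_d3 br H x y z w = 0)"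

section \<open>Generalized complex structures\<close>

text \<open>
  \<open>Abs_dual\<close> is meaningful only on linear functionals; the functional below is linear as
  soon as \<open>br\<close> is bilinear and \<open>H\<close> is a 3-form.
\<close>

definition courant ::
  "('g \<Rightarrow> 'g \<Rightarrow> 'g) \<Rightarrow> ('g \<Rightarrow> 'g \<Rightarrow> 'g \<Rightarrow> real) \<Rightarrow>
   'g::real_vector \<times> 'g dual \<Rightarrow> 'g \<times> 'g dual \<Rightarrow> 'g \<times> 'g dual" where
  "courant br H = (\<lambda>(X, \<xi>) (Y, \<eta>).
     (br X Y, Abs_dual (\<lambda>Z. ce_d1 br (ev \<eta>) X Z - ce_d1 br (ev \<xi>) Y Z + H Y X Z)))"

definition canonical_form :: "'g::real_vector \<times> 'g dual \<Rightarrow> 'g \<times> 'g dual \<Rightarrow> real" where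
  "canonical_form = (\<lambda>(X, \<xi>) (Y, \<eta>). (ev \<eta> X + ev \<xi> Y) / 2)"

text \<open>
  The complexification of a real vector space \<open>'e\<close> is \<open>'e \<times> 'e\<close>, where \<open>(a, b)\<close> stands for
  \<open>a + i b\<close>.
\<close>

definition cscale :: "complex \<Rightarrow> 'e::real_vector \<times> 'e \<Rightarrow> 'e \<times> 'e" where
  "cscale c = (\<lambda>(a, b). (Re c *\<^sub>R a - Im c *\<^sub>R b, Re c *\<^sub>R b + Im c *\<^sub>R a))"

lemma vector_space_cscale: "vector_space cscale"
  by unfold_locales (auto simp: cscale_def algebra_simps)

definition cmap :: "('e \<Rightarrow> 'f) \<Rightarrow> 'e \<times> 'e \<Rightarrow> 'f \<times> 'f" where
  "cmap f = (\<lambda>(a, b). (f a, f b))"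

definition cbilin ::
  "('e \<Rightarrow> 'e \<Rightarrow> 'e::real_vector) \<Rightarrow> 'e \<times> 'e \<Rightarrow> 'e \<times> 'e \<Rightarrow> 'e \<times> 'e" where
  "cbilin B = (\<lambda>(a, b) (a', b'). (B a a' - B b b', B a b' + B b a'))"

definition i_eigenspace :: "('e::real_vector \<Rightarrow> 'e) \<Rightarrow> ('e \<times> 'e) set" where
  "i_eigenspace J = {u. cmap J u = cscale \<i> u}"

definition generalized_complex_structure ::
  "('g \<Rightarrow> 'g \<Rightarrow> 'g) \<Rightarrow> ('g \<Rightarrow> 'g \<Rightarrow> 'g \<Rightarrow> real) \<Rightarrow>
   ('g::real_vector \<times> 'g dual \<Rightarrow> 'g \<times> 'g dual) \<Rightarrow> bool" where
  "generalized_complex_structure br H J \<longleftrightarrow>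
     linear J \<and>
     (\<forall>e. J (J e) = - e) \<and>
     (\<forall>e f. canonical_form (J e) (J f) = canonical_form e f) \<and>
     (\<forall>u\<in>i_eigenspace J. \<forall>v\<in>i_eigenspace J. cbilin (courant br H) u v \<in> i_eigenspace J)"

section \<open>Dual triples\<close>

definition admissible ::
  "('g::real_vector \<Rightarrow> 'g \<Rightarrow> 'g) \<Rightarrow> 'g set \<Rightarrow> ('g \<Rightarrow> 'g \<Rightarrow> 'g \<Rightarrow> real) \<Rightarrow> bool" where
  "admissible br A H \<longleftrightarrow>
     lie_algebra br \<and> abelian_ideal br A \<and> closed_three_form br H \<and>
     (\<forall>x\<in>A. \<forall>y\<in>A. \<forall>z. H x y z = 0)"

text \<open>
  \<open>q\<close> identifies the Lie algebra on \<open>'n\<close> with the quotient by \<open>A\<close>.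
\<close>

definition lie_quotient_map ::
  "('g::real_vector \<Rightarrow> 'g \<Rightarrow> 'g) \<Rightarrow> 'g set \<Rightarrow> ('n::real_vector \<Rightarrow> 'n \<Rightarrow> 'n) \<Rightarrow> ('g \<Rightarrow> 'n) \<Rightarrow> bool" where
  "lie_quotient_map br A brn q \<longleftrightarrow>
     linear q \<and> (\<forall>x y. q (br x y) = brn (q x) (q y)) \<and> surj q \<and> {x. q x = 0} = A"

definition fibre_product :: "('g \<Rightarrow> 'n) \<Rightarrow> ('h \<Rightarrow> 'n) \<Rightarrow> ('g \<times> 'h) set" where
  "fibre_product q q' = {(x, y). q x = q' y}"

definition sum_bracket ::
  "('g \<Rightarrow> 'g \<Rightarrow> 'g) \<Rightarrow> ('h \<Rightarrow> 'h \<Rightarrow> 'h) \<Rightarrow> 'g \<times> 'h \<Rightarrow> 'g \<times> 'h \<Rightarrow> 'g \<times> 'h" where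
  "sum_bracket br br' = (\<lambda>(x, y) (x', y'). (br x x', br' y y'))"

definition nondegenerate_in_fibres ::
  "'g::zero set \<Rightarrow> 'h::zero set \<Rightarrow> ('g \<times> 'h \<Rightarrow> 'g \<times> 'h \<Rightarrow> real) \<Rightarrow> bool" where
  "nondegenerate_in_fibres A A' F \<longleftrightarrow>
     (\<forall>x\<in>A. (\<forall>y\<in>A'. F (x, 0) (0, y) = 0) \<longrightarrow> x = 0) \<and>
     (\<forall>y\<in>A'. (\<forall>x\<in>A. F (x, 0) (0, y) = 0) \<longrightarrow> y = 0)"

definition duality_form ::
  "('g::real_vector \<Rightarrow> 'g \<Rightarrow> 'g) \<Rightarrow> 'g set \<Rightarrow> ('g \<Rightarrow> 'g \<Rightarrow> 'g \<Rightarrow> real) \<Rightarrow> ('g \<Rightarrow> 'n) \<Rightarrow>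
   ('h::real_vector \<Rightarrow> 'h \<Rightarrow> 'h) \<Rightarrow> 'h set \<Rightarrow> ('h \<Rightarrow> 'h \<Rightarrow> 'h \<Rightarrow> real) \<Rightarrow> ('h \<Rightarrow> 'n) \<Rightarrow>
   ('g \<times> 'h \<Rightarrow> 'g \<times> 'h \<Rightarrow> real) \<Rightarrow> bool" where
  "duality_form br A H q br' A' H' q' F \<longleftrightarrow>
     two_form_on (fibre_product q q') F \<and>
     nondegenerate_in_fibres A A' F \<and>
     (\<forall>u\<in>fibre_product q q'. \<forall>v\<in>fibre_product q q'. \<forall>w\<in>fibre_product q q'.
        H (fst u) (fst v) (fst w) - H' (snd u) (snd v) (snd w)
          = ce_d2 (sum_bracket br br') F u v w)"

definition phi_lift ::
  "'g::real_vector set \<Rightarrow> ('g \<Rightarrow> 'n) \<Rightarrow> ('h::real_vector \<Rightarrow> 'n) \<Rightarrow> ('g \<times> 'h \<Rightarrow> 'g \<times> 'h \<Rightarrow> real) \<Rightarrow>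
   'g \<Rightarrow> 'g dual \<Rightarrow> 'g \<times> 'h" where
  "phi_lift A q q' F x \<xi> =
     (THE u. u \<in> fibre_product q q' \<and> fst u = x \<and> (\<forall>a\<in>A. ev \<xi> a - F u (a, 0) = 0))"

definition phi ::
  "'g::real_vector set \<Rightarrow> ('g \<Rightarrow> 'n) \<Rightarrow> ('h::real_vector \<Rightarrow> 'n) \<Rightarrow> ('g \<times> 'h \<Rightarrow> 'g \<times> 'h \<Rightarrow> real) \<Rightarrow>
   'g \<times> 'g dual \<Rightarrow> 'h \<times> 'h dual" where
  "phi A q q' F = (\<lambda>(x, \<xi>).
     let u = phi_lift A q q' F x \<xi>
     in (snd u, THE \<sigma>. \<forall>w\<in>fibre_product q q'. ev \<xi> (fst w) - F u w = ev \<sigma> (snd w)))"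

end

theory Submission
  imports Defs
begin

text \<open>
  Write \<open>u = (x, y)\<close> for an element of \<open>\<cc>\<close>.  The graph of \<open>\<phi>\<close> is the relation
  \<open>p\<^sup>*\<xi> - F(u, \<cdot>) = p'\<^sup>*\<sigma>\<close> between \<open>x + \<xi>\<close> and \<open>y + \<sigma>\<close>.  This relation is symmetric under
  exchanging the two triples and replacing \<open>F\<close> by \<open>-F\<close>, so a single existence and uniqueness
  argument, resting on the perfect pairing between \<open>\<aa>\<close> and \<open>\<aa>'\<close>, shows that \<open>\<phi>\<close> is bijective.
  Skew-symmetry of \<open>F\<close> makes the relation preserve the canonical form, and
  \<open>p\<^sup>*H - p'\<^sup>*H' = dF\<close> is exactly what makes it preserve the Courant brackets.  Conjugation by
  a linear bijection that preserves form and bracket preserves generalized complex structures.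
\<close>

section \<open>Perfect pairings\<close>

lemma linear_form_on_eq_span:
  assumes "linear_form_on (span B) f" and "linear_form_on (span B) g"
    and "\<And>b. b \<in> B \<Longrightarrow> f b = g b" and "x \<in> span B"
  shows "f x = g x"
proof -
  \<comment> \<open>Membership in the span is carried through the induction because the forms are
    additive and homogeneous only there.\<close>
  have "x \<in> span B \<and> f x = g x"
    using assms(4)
  proof (induction rule: span_induct_alt)
    case base
    have "f (0 *\<^sub>R 0) = 0 * f 0" "g (0 *\<^sub>R 0) = 0 * g 0"
      using assms(1,2) span_zero unfolding linear_form_on_def by blast+
    then show ?case by (simp add: span_zero)
  next
    case (step c b y)
    have b: "b \<in> span B" using step by (simp add: span_base)
    then have cb: "c *\<^sub>R b \<in> span B" by (rule span_scale)
    have "f (c *\<^sub>R b + y) = c * f b + f y" "g (c *\<^sub>R b + y) = c * g b + g y"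
      using assms(1,2) b cb step unfolding linear_form_on_def by metis+
    with step assms(3) cb show ?case by (auto intro: span_add)
  qed
  then show ?thesis by simp
qed

text \<open>\<open>T\<close> sends \<open>y\<close> to the vector whose coordinates in
  \<open>B\<close> are those of the form \<open>P _ y\<close>. If they all vanish, so does that form
  on \<open>span B\<close>, and then \<open>y = 0\<close> by nondegeneracy. Hence \<open>T\<close>
  embeds \<open>span B'\<close> into \<open>span B\<close>, which compares the two
  dimensions.\<close>

lemma pairing_embedding:
  fixes P :: "'a::real_vector \<Rightarrow> 'b::real_vector \<Rightarrow> real"
  assumes B: "independent B" "finite B" and B': "independent B'"
    and lin1: "\<And>y. y \<in> span B' \<Longrightarrow> linear_form_on (span B) (\<lambda>x. P x y)"
    and lin2: "\<And>x. x \<in> span B \<Longrightarrow> linear_form_on (span B') (P x)"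
    and nondeg: "\<And>y. y \<in> span B' \<Longrightarrow> (\<And>x. x \<in> span B \<Longrightarrow> P x y = 0) \<Longrightarrow> y = 0"
  shows "\<exists>T. linear T \<and> (\<forall>y\<in>span B'. T y = (\<Sum>b\<in>B. P b y *\<^sub>R b)) \<and>
    independent (T ` B') \<and> card (T ` B') = card B'"
proof -
  \<comment> \<open>The sum need not be linear in \<open>y\<close> outside \<open>span B'\<close>,
    so only its values on the basis are used and extended to a linear map on the whole type.\<close>
  define T where "T = real_vector.construct B' (\<lambda>y. \<Sum>b\<in>B. P b y *\<^sub>R b)"
  have T: "linear T"
    unfolding T_def by (rule real_vector.linear_construct[OF B'])
  have T_eq': "y \<in> span B' \<and> T y = (\<Sum>b\<in>B. P b y *\<^sub>R b)" if "y \<in> span B'" for y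
    using that
  proof (induction rule: span_induct_alt)
    case base
    have "P b (0 *\<^sub>R 0) = 0 * P b 0" if "b \<in> B" for b
      using lin2[of b] that span_base span_zero unfolding linear_form_on_def by blast
    then show ?case by (simp add: linear_0[OF T] span_zero)
  next
    case (step c y z)
    have y: "y \<in> span B'" "c *\<^sub>R y \<in> span B'"
      using step(1) by (auto intro: span_base span_scale)
    have z: "z \<in> span B'" using step by blast
    have "P b (c *\<^sub>R y + z) = c * P b y + P b z" if "b \<in> B" for b
      using lin2[of b] span_base[OF that] y z unfolding linear_form_on_def by metis
    then have "(\<Sum>b\<in>B. P b (c *\<^sub>R y + z) *\<^sub>R b)
        = c *\<^sub>R (\<Sum>b\<in>B. P b y *\<^sub>R b) + (\<Sum>b\<in>B. P b z *\<^sub>R b)"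
      by (simp add: scaleR_sum_right scaleR_add_left sum.distrib)
    moreover have "T y = (\<Sum>b\<in>B. P b y *\<^sub>R b)"
      unfolding T_def using step(1) by (rule real_vector.construct_basis[OF B'])
    ultimately show ?case
      using step y by (simp add: linear_add[OF T] linear_scale[OF T] span_add)
  qed
  then have T_eq: "T y = (\<Sum>b\<in>B. P b y *\<^sub>R b)" if "y \<in> span B'" for y
    using that by blast
  have inj: "inj_on T (span B')"
    unfolding real_vector.linear_inj_on_iff_eq_0[OF T subspace_span]
  proof (intro ballI impI)
    fix y assume y: "y \<in> span B'" and "T y = 0"
    then have sum0: "(\<Sum>b\<in>B. P b y *\<^sub>R b) = 0" by (simp add: T_eq)
    have P0: "P b y = 0" if "b \<in> B" for b
      using real_vector.independentD[OF B(1,2) subset_refl sum0 that] .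
    have "P x y = 0" if "x \<in> span B" for x
      by (rule linear_form_on_eq_span[OF lin1[OF y] _ _ that, of "\<lambda>_. 0"])
        (auto simp: linear_form_on_def P0)
    then show "y = 0" using nondeg[OF y] by blast
  qed
  have "independent (T ` B')"
    by (rule real_vector.linear_independent_injective_image[OF T B' inj])
  moreover have "card (T ` B') = card B'"
    by (rule card_image) (rule inj_on_subset[OF inj span_superset])
  ultimately show ?thesis using T T_eq by blast
qed

lemma finite_basis_of_subspace:
  fixes A :: "'a::real_vector set"
  assumes "subspace A" and "\<exists>S :: 'a set. finite S \<and> span S = UNIV"
  obtains B where "finite B" "independent B" "span B = A"
proof -
  obtain B where B: "B \<subseteq> A" "independent B" "A \<subseteq> span B"
    using real_vector.maximal_independent_subset by blast
  obtain S :: "'a set" where "finite S" "span S = UNIV" using assms(2) by blast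
  then have "finite B"
    using real_vector.independent_span_bound[of S B] B(2) by simp
  moreover have "span B = A"
    using B(1,3) assms(1) by (simp add: span_minimal subset_antisym)
  ultimately show thesis using that B(2) by blast
qed

text \<open>Nondegeneracy on either side embeds each space into the other, so the dimensions agree
  and the embedding \<open>T\<close> of \<open>A'\<close> into \<open>A\<close> is onto. The
  representing vector is a preimage under \<open>T\<close> of the vector with coordinates
  \<open>f b\<close>.\<close>

lemma perfect_pairing:
  fixes P :: "'a::real_vector \<Rightarrow> 'b::real_vector \<Rightarrow> real"
  assumes A: "subspace A" "\<exists>S :: 'a set. finite S \<and> span S = UNIV"
    and A': "subspace A'" "\<exists>S :: 'b set. finite S \<and> span S = UNIV"
    and lin1: "\<And>y. y \<in> A' \<Longrightarrow> linear_form_on A (\<lambda>x. P x y)"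
    and lin2: "\<And>x. x \<in> A \<Longrightarrow> linear_form_on A' (P x)"
    and nondeg1: "\<And>x. x \<in> A \<Longrightarrow> (\<And>y. y \<in> A' \<Longrightarrow> P x y = 0) \<Longrightarrow> x = 0"
    and nondeg2: "\<And>y. y \<in> A' \<Longrightarrow> (\<And>x. x \<in> A \<Longrightarrow> P x y = 0) \<Longrightarrow> y = 0"
    and f: "linear_form_on A f"
  shows "\<exists>y\<in>A'. \<forall>x\<in>A. P x y = f x"
proof -
  obtain B where B: "finite B" "independent B" and spB: "span B = A"
    using finite_basis_of_subspace[OF A] by blast
  obtain B' where B': "finite B'" "independent B'" and spB': "span B' = A'"
    using finite_basis_of_subspace[OF A'] by blast
  have "\<exists>T. linear T \<and> (\<forall>y\<in>A'. T y = (\<Sum>b\<in>B. P b y *\<^sub>R b)) \<and>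
      independent (T ` B') \<and> card (T ` B') = card B'"
    by (rule pairing_embedding[of B B' P, unfolded spB spB'])
      (fact B(1) B(2) B'(2) lin1 lin2 nondeg2)+
  then obtain T where T: "linear T" and T_eq: "\<And>y. y \<in> A' \<Longrightarrow> T y = (\<Sum>b\<in>B. P b y *\<^sub>R b)"
    and TB': "independent (T ` B')" "card (T ` B') = card B'"
    by blast
  have "\<exists>T'. linear T' \<and> (\<forall>x\<in>A. T' x = (\<Sum>b\<in>B'. P x b *\<^sub>R b)) \<and>
      independent (T' ` B) \<and> card (T' ` B) = card B"
    by (rule pairing_embedding[of B' B "\<lambda>y x. P x y", unfolded spB spB'])
      (fact B(2) B'(1) B'(2) lin1 lin2 nondeg1)+
  then obtain T' where T'_eq: "\<And>x. x \<in> A \<Longrightarrow> T' x = (\<Sum>b\<in>B'. P x b *\<^sub>R b)"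
    and T'B: "independent (T' ` B)" "card (T' ` B) = card B"
    by blast
  \<comment> \<open>The reverse embedding serves only to bound \<open>card B\<close> by
    \<open>card B'\<close>.\<close>
  have "T' ` B \<subseteq> span B'"
    using T'_eq span_base[of _ B] unfolding spB
    by (auto intro!: span_sum span_scale intro: span_base)
  then have card_le: "card B \<le> card B'"
    using real_vector.independent_span_bound[OF B'(1) T'B(1)] T'B(2) by simp
  have TB'_sub: "T ` B' \<subseteq> span B"
    using T_eq span_base[of _ B'] unfolding spB'
    by (auto intro!: span_sum span_scale intro: span_base)
  have onto: "A \<subseteq> span (T ` B')"
  \<comment> \<open>A vector of \<open>A\<close> outside the span of the image of \<open>B'\<close>
    would enlarge that image to an independent subset of \<open>span B\<close> with more than
    \<open>card B\<close> elements.\<close>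
  proof (rule ccontr)
    assume "\<not> A \<subseteq> span (T ` B')"
    then obtain x where x: "x \<in> A" "x \<notin> span (T ` B')" by blast
    then have "independent (insert x (T ` B'))"
      using TB'(1) by (intro real_vector.independent_insertI)
    moreover have "insert x (T ` B') \<subseteq> span B" using x(1) spB TB'_sub by blast
    ultimately have "card (insert x (T ` B')) \<le> card B"
      using real_vector.independent_span_bound[OF B(1)] by blast
    moreover have "x \<notin> T ` B'" by (rule contra_subsetD[OF span_superset x(2)])
    ultimately show False using card_le TB'(2) B'(1) by simp
  qed
  have "(\<Sum>b\<in>B. f b *\<^sub>R b) \<in> span B"
    by (rule span_sum, rule span_scale, rule span_base)
  also have "span B \<subseteq> T ` A'"
    using onto by (simp add: span_linear_image[OF T] spB spB')
  finally have "(\<Sum>b\<in>B. f b *\<^sub>R b) \<in> T ` A'" .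
  then obtain y where y: "y \<in> A'" "T y = (\<Sum>b\<in>B. f b *\<^sub>R b)" by auto
  then have "(\<Sum>b\<in>B. (P b y - f b) *\<^sub>R b) = 0"
    by (simp add: T_eq scaleR_diff_left sum_subtractf)
  then have P_eq: "P b y = f b" if "b \<in> B" for b
    using real_vector.independentD[OF B(2,1) subset_refl _ that, of "\<lambda>b. P b y - f b"] by simp
  have "P x y = f x" if "x \<in> A" for x
    by (rule linear_form_on_eq_span[of B "\<lambda>x. P x y" f, unfolded spB, OF lin1[OF y(1)] f P_eq that])
  with y(1) show ?thesis by blast
qed

section \<open>The map \<open>\<phi>\<close>\<close>

lemma linear_ev: "linear (ev f)"
  using ev[of f] by simp

lemma dual_eqI: "(\<And>x. ev f x = ev g x) \<Longrightarrow> f = g"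
  by (simp add: ev_inject[symmetric] fun_eq_iff)

lemma ev_Abs_dual: "linear f \<Longrightarrow> ev (Abs_dual f) = f"
  by (rule Abs_dual_inverse) simp

text \<open>Brackets and 3-forms are left out: that \<phi> is a linear bijection preserving the
  canonical form depends on the linear data alone. The assumptions are symmetric in the two sides,
  so the locale can be interpreted with the sides exchanged.\<close>

locale fibre_pairing =
  fixes A :: "'g::real_vector set" and q :: "'g \<Rightarrow> 'n::real_vector"
    and A' :: "'h::real_vector set" and q' :: "'h \<Rightarrow> 'n"
    and F :: "'g \<times> 'h \<Rightarrow> 'g \<times> 'h \<Rightarrow> real"
  assumes fin: "\<exists>B :: 'g set. finite B \<and> span B = UNIV"
    and fin': "\<exists>B :: 'h set. finite B \<and> span B = UNIV"
    and q: "linear q" "surj q" "{x. q x = 0} = A"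
    and q': "linear q'" "surj q'" "{x. q' x = 0} = A'"
    and F: "two_form_on (fibre_product q q') F"
    and nondeg: "nondegenerate_in_fibres A A' F"
begin

abbreviation C where "C \<equiv> fibre_product q q'"

text \<open>The pair \<open>(fst e, fst e')\<close> is the lift \<open>u_x\<close> and
  \<open>snd e'\<close> is the descended form \<open>\<sigma>\<close>.\<close>

definition related :: "'g \<times> 'g dual \<Rightarrow> 'h \<times> 'h dual \<Rightarrow> bool" where
  "related e e' \<longleftrightarrow> q (fst e) = q' (fst e') \<and>
     (\<forall>w\<in>C. ev (snd e) (fst w) - F (fst e, fst e') w = ev (snd e') (snd w))"

section \<open>Linear algebra of the fibre product and its 2-form\<close>

lemma A_iff: "a \<in> A \<longleftrightarrow> q a = 0"
  using q(3) by blast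

lemma A'_iff: "a \<in> A' \<longleftrightarrow> q' a = 0"
  using q'(3) by blast

lemma C_iff: "w \<in> C \<longleftrightarrow> q (fst w) = q' (snd w)"
  by (simp add: fibre_product_def case_prod_beta)

lemmas q_simps = linear_add[OF q(1)] linear_diff[OF q(1)] linear_scale[OF q(1)] linear_0[OF q(1)]
  linear_add[OF q'(1)] linear_diff[OF q'(1)] linear_scale[OF q'(1)] linear_0[OF q'(1)]

lemma subspace_A: "subspace A" and subspace_A': "subspace A'"
  by (auto simp: subspace_def A_iff A'_iff q_simps)

lemma C_add: "u \<in> C \<Longrightarrow> v \<in> C \<Longrightarrow> u + v \<in> C"
  and C_diff: "u \<in> C \<Longrightarrow> v \<in> C \<Longrightarrow> u - v \<in> C"
  and C_scale: "u \<in> C \<Longrightarrow> c *\<^sub>R u \<in> C"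
  by (auto simp: C_iff q_simps)

lemma fibre_in_C: "a \<in> A \<Longrightarrow> (a, 0) \<in> C" and fibre'_in_C: "b \<in> A' \<Longrightarrow> (0, b) \<in> C"
  by (auto simp: C_iff A_iff A'_iff q_simps)

lemma ex_snd: "\<exists>y. (x, y) \<in> C" and ex_fst: "\<exists>x. (x, y) \<in> C"
  using q(2) q'(2) unfolding C_iff surj_def by (simp_all, metis+)

lemma F_add: "u \<in> C \<Longrightarrow> v \<in> C \<Longrightarrow> w \<in> C \<Longrightarrow> F (u + v) w = F u w + F v w"
  and F_scale: "u \<in> C \<Longrightarrow> w \<in> C \<Longrightarrow> F (c *\<^sub>R u) w = c * F u w"
  and F_add_right: "u \<in> C \<Longrightarrow> v \<in> C \<Longrightarrow> w \<in> C \<Longrightarrow> F w (u + v) = F w u + F w v"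
  and F_scale_right: "u \<in> C \<Longrightarrow> w \<in> C \<Longrightarrow> F w (c *\<^sub>R u) = c * F w u"
  and F_self: "u \<in> C \<Longrightarrow> F u u = 0"
  using F unfolding two_form_on_def linear_form_on_def by blast+

lemma F_diff: "u \<in> C \<Longrightarrow> v \<in> C \<Longrightarrow> w \<in> C \<Longrightarrow> F (u - v) w = F u w - F v w"
  using F_add[of "u - v" v w] C_diff by simp

lemma F_diff_right: "u \<in> C \<Longrightarrow> v \<in> C \<Longrightarrow> w \<in> C \<Longrightarrow> F w (u - v) = F w u - F w v"
  using F_add_right[of "u - v" v w] C_diff by simp

lemma F_skew: "u \<in> C \<Longrightarrow> v \<in> C \<Longrightarrow> F u v = - F v u"
  using F_self[of "u + v"] F_add[of u v "u + v"] F_add_right[of u v u] F_add_right[of u v v]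
    F_self[of u] F_self[of v] C_add[of u v] by simp

text \<open>Any lift \<open>(x, y0)\<close> may be shifted by \<open>(0, b)\<close> with
  \<open>b\<close> in \<open>A'\<close>. By skew-symmetry the condition on \<open>A\<close> becomes
  \<open>F (a, 0) (0, b) = F (x, y0) (a, 0) - ev \<xi> a\<close>, which the perfect pairing solves
  for \<open>b\<close>.\<close>

lemma lift_ex:
  "\<exists>u\<in>C. fst u = x \<and> (\<forall>a\<in>A. ev \<xi> a - F u (a, 0) = 0)"
proof -
  obtain y0 where y0: "(x, y0) \<in> C" using ex_snd by blast
  define P where "P a b = F (a, 0) (0, b)" for a b
  have lin1: "linear_form_on A (\<lambda>a. P a b)" if "b \<in> A'" for b
    using F_add[OF fibre_in_C fibre_in_C fibre'_in_C[OF that]]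
      F_scale[OF fibre_in_C fibre'_in_C[OF that]]
    by (auto simp: linear_form_on_def P_def)
  have lin2: "linear_form_on A' (P a)" if "a \<in> A" for a
    using F_add_right[OF fibre'_in_C fibre'_in_C fibre_in_C[OF that]]
      F_scale_right[OF fibre'_in_C fibre_in_C[OF that]]
    by (auto simp: linear_form_on_def P_def)
  have nondeg1: "a = 0" if "a \<in> A" "\<And>b. b \<in> A' \<Longrightarrow> P a b = 0" for a
    using nondeg that unfolding nondegenerate_in_fibres_def P_def by blast
  have nondeg2: "b = 0" if "b \<in> A'" "\<And>a. a \<in> A \<Longrightarrow> P a b = 0" for b
    using nondeg that unfolding nondegenerate_in_fibres_def P_def by blast
  have form: "linear_form_on A (\<lambda>a. F (x, y0) (a, 0) - ev \<xi> a)"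
    using F_add_right[OF fibre_in_C fibre_in_C y0] F_scale_right[OF fibre_in_C y0]
    by (auto simp: linear_form_on_def algebra_simps linear_add[OF linear_ev]
        linear_scale[OF linear_ev])
  have "\<exists>b\<in>A'. \<forall>a\<in>A. P a b = F (x, y0) (a, 0) - ev \<xi> a"
    by (rule perfect_pairing[OF subspace_A fin subspace_A' fin'])
      (fact lin1 lin2 nondeg1 nondeg2 form)+
  then obtain b where b: "b \<in> A'" "\<And>a. a \<in> A \<Longrightarrow> P a b = F (x, y0) (a, 0) - ev \<xi> a"
    by blast
  have u: "(x, y0 + b) \<in> C" using C_add[OF y0 fibre'_in_C[OF b(1)]] by simp
  have "ev \<xi> a - F (x, y0 + b) (a, 0) = 0" if "a \<in> A" for a
    using F_add[OF y0 fibre'_in_C[OF b(1)] fibre_in_C[OF that]] b(2)[OF that]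
      F_skew[OF fibre'_in_C[OF b(1)] fibre_in_C[OF that]]
    by (simp add: P_def)
  with u show ?thesis by force
qed

text \<open>Two lifts differ by some \<open>(0, b)\<close> with \<open>b\<close> in
  \<open>A'\<close>. Subtracting their conditions makes it orthogonal to every
  \<open>(a, 0)\<close>, so \<open>b = 0\<close> by nondegeneracy in the fibres.\<close>

lemma lift_unique:
  assumes "u \<in> C" "fst u = x" "\<forall>a\<in>A. ev \<xi> a - F u (a, 0) = 0"
    and "v \<in> C" "fst v = x" "\<forall>a\<in>A. ev \<xi> a - F v (a, 0) = 0"
  shows "u = v"
proof -
  let ?b = "snd u - snd v"
  have uv: "u - v = (0, ?b)" using assms(2,5) by (simp add: prod_eq_iff)
  have b: "?b \<in> A'" using C_diff[OF assms(1,4)] by (simp add: C_iff A'_iff assms(2,5) q_simps)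
  have "F (a, 0) (0, ?b) = 0" if "a \<in> A" for a
    using F_diff[OF assms(1,4) fibre_in_C[OF that]] assms(3,6) that
      F_skew[OF fibre_in_C[OF that] fibre'_in_C[OF b]] unfolding uv by fastforce
  then have "?b = 0" using nondeg b unfolding nondegenerate_in_fibres_def by blast
  then show ?thesis using assms(2,5) by (simp add: prod_eq_iff)
qed

text \<open>The form \<open>h\<close> below vanishes on the kernel of \<open>snd\<close> on
  \<open>C\<close>, which consists of the \<open>(a, 0)\<close> with \<open>a\<close> in
  \<open>A\<close>. Hence \<open>h w\<close> depends only on \<open>snd w\<close>.\<close>

lemma ex_descended_form:
  assumes u: "u \<in> C" "\<forall>a\<in>A. ev \<xi> a - F u (a, 0) = 0"
  shows "\<exists>\<sigma>. \<forall>w\<in>C. ev \<xi> (fst w) - F u w = ev \<sigma> (snd w)"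
proof -
  define h where "h w = ev \<xi> (fst w) - F u w" for w
  have h_eq: "h v = h w" if "v \<in> C" "w \<in> C" "snd v = snd w" for v w
  proof -
    have vw: "v - w = (fst v - fst w, 0)" using that(3) by (simp add: prod_eq_iff)
    have "fst v - fst w \<in> A" using that by (simp add: C_iff A_iff q_simps)
    then have "ev \<xi> (fst v - fst w) = F u (v - w)" using u(2) unfolding vw by force
    then show ?thesis
      unfolding h_def using F_diff_right[OF that(1,2) u(1)]
      by (simp add: linear_diff[OF linear_ev])
  qed
  \<comment> \<open>The section \<open>s\<close> need not be linear. By \<open>h_eq\<close> the
    value of \<open>h\<close> does not depend on the chosen preimage, and this gives
    linearity.\<close>
  define s where "s y = (SOME x. (x, y) \<in> C)" for y
  have s: "(s y, y) \<in> C" for y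
    unfolding s_def using ex_fst by (rule someI_ex)
  have "linear (\<lambda>y. h (s y, y))"
  proof (rule linearI)
    fix y z and c :: real
    have "h (s (y + z), y + z) = h ((s y, y) + (s z, z))"
      using s C_add[OF s s] by (intro h_eq) simp_all
    then show "h (s (y + z), y + z) = h (s y, y) + h (s z, z)"
      unfolding h_def using F_add_right[OF s s u(1)] by (simp add: linear_add[OF linear_ev])
    have "h (s (c *\<^sub>R y), c *\<^sub>R y) = h (c *\<^sub>R (s y, y))"
      using s C_scale[OF s] by (intro h_eq) simp_all
    then show "h (s (c *\<^sub>R y), c *\<^sub>R y) = c *\<^sub>R h (s y, y)"
      unfolding h_def using F_scale_right[OF s u(1)]
      by (simp add: linear_scale[OF linear_ev] algebra_simps)
  qed
  then have "h w = ev (Abs_dual (\<lambda>y. h (s y, y))) (snd w)" if "w \<in> C" for w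
    using h_eq[OF s that] by (simp add: ev_Abs_dual)
  then have "\<exists>\<sigma>. \<forall>w\<in>C. h w = ev \<sigma> (snd w)" by blast
  then show ?thesis unfolding h_def .
qed

text \<open>At \<open>w = (a, 0)\<close> the right-hand side of the relation is zero, which leaves
  exactly the defining condition of the lift.\<close>

lemma related_lift:
  assumes "related e e'"
  shows "(fst e, fst e') \<in> C" "\<forall>a\<in>A. ev (snd e) a - F (fst e, fst e') (a, 0) = 0"
proof -
  show "(fst e, fst e') \<in> C" using assms by (simp add: related_def C_iff)
  show "\<forall>a\<in>A. ev (snd e) a - F (fst e, fst e') (a, 0) = 0"
  proof
    fix a assume "a \<in> A"
    then show "ev (snd e) a - F (fst e, fst e') (a, 0) = 0"
      using assms fibre_in_C[of a] by (force simp: related_def linear_0[OF linear_ev])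
  qed
qed

text \<open>Pullback along \<open>snd\<close> is injective because \<open>snd\<close> maps
  \<open>C\<close> onto the whole type.\<close>

lemma dual_eqI_snd: "(\<And>w. w \<in> C \<Longrightarrow> ev \<sigma> (snd w) = ev \<tau> (snd w)) \<Longrightarrow> \<sigma> = \<tau>"
  using ex_fst by (metis dual_eqI snd_conv)

section \<open>The relation as the graph of a linear isometry\<close>

lemma related_unique:
  assumes "related e e'" "related e f'"
  shows "e' = f'"
proof (rule prod_eqI)
  have "(fst e, fst e') = (fst e, fst f')"
    by (rule lift_unique[where \<xi> = "snd e" and x = "fst e"])
      (use related_lift[OF assms(1)] related_lift[OF assms(2)] in simp_all)
  then show eq: "fst e' = fst f'" by simp
  show "snd e' = snd f'"
    using assms by (intro dual_eqI_snd) (metis related_def eq)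
qed

lemma related_ex: "\<exists>e'. related e e'"
proof -
  obtain u where u: "u \<in> C" "fst u = fst e" "\<forall>a\<in>A. ev (snd e) a - F u (a, 0) = 0"
    using lift_ex by blast
  obtain \<sigma> where "\<forall>w\<in>C. ev (snd e) (fst w) - F u w = ev \<sigma> (snd w)"
    using ex_descended_form[OF u(1,3)] by blast
  moreover have "(fst e, snd u) = u" using u(2) by (simp add: prod_eq_iff)
  ultimately have "related e (snd u, \<sigma>)"
    unfolding related_def using u(1,2) by (simp add: C_iff)
  then show ?thesis by blast
qed

text \<open>The two definite descriptions inside \<open>phi\<close> are resolved here once; every
  later fact about \<open>phi\<close> is read off from the relation.\<close>

lemma phi_eqI:
  assumes "related e e'"
  shows "phi A q q' F e = e'"
proof -
  obtain x \<xi> where e: "e = (x, \<xi>)" by (cases e)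
  note lift = related_lift[OF assms]
  have lift_eq: "phi_lift A q q' F x \<xi> = (x, fst e')"
    unfolding phi_lift_def
  proof (rule the_equality)
    show "(x, fst e') \<in> C \<and> fst (x, fst e') = x \<and> (\<forall>a\<in>A. ev \<xi> a - F (x, fst e') (a, 0) = 0)"
      using lift by (simp add: e)
    then show "u = (x, fst e')"
      if "u \<in> C \<and> fst u = x \<and> (\<forall>a\<in>A. ev \<xi> a - F u (a, 0) = 0)" for u
      using that lift_unique by blast
  qed
  have "(THE \<sigma>. \<forall>w\<in>C. ev \<xi> (fst w) - F (x, fst e') w = ev \<sigma> (snd w)) = snd e'"
  proof (rule the_equality)
    show *: "\<forall>w\<in>C. ev \<xi> (fst w) - F (x, fst e') w = ev (snd e') (snd w)"
      using assms by (simp add: related_def e)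
    show "\<sigma> = snd e'"
      if "\<forall>w\<in>C. ev \<xi> (fst w) - F (x, fst e') w = ev \<sigma> (snd w)" for \<sigma>
      using * that by (intro dual_eqI_snd) simp
  qed
  then show ?thesis
    by (simp add: phi_def e lift_eq)
qed

lemma related_phi: "related e (phi A q q' F e)"
  using related_ex[of e] phi_eqI by metis

text \<open>The relation is closed under sums and multiples, as \<open>F\<close> is linear in its
  first argument on \<open>C\<close>; uniqueness transfers this to \<open>phi\<close>.\<close>

lemma linear_phi: "linear (phi A q q' F)"
proof (rule linearI)
  fix e f :: "'g \<times> 'g dual" and c :: real
  note e = related_phi[of e] and f = related_phi[of f]
  let ?e' = "phi A q q' F e" and ?f' = "phi A q q' F f"
  have "F (fst e + fst f, fst ?e' + fst ?f') w
      = F (fst e, fst ?e') w + F (fst f, fst ?f') w" if "w \<in> C" for w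
    using F_add[OF related_lift(1)[OF e] related_lift(1)[OF f] that] by simp
  then have "related (e + f) (?e' + ?f')"
    using e f by (auto simp: related_def q_simps plus_dual.rep_eq algebra_simps)
  then show "phi A q q' F (e + f) = ?e' + ?f'" by (rule phi_eqI)
  have "F (c *\<^sub>R fst e, c *\<^sub>R fst ?e') w = c * F (fst e, fst ?e') w" if "w \<in> C" for w
    using F_scale[OF related_lift(1)[OF e] that] by simp
  then have "related (c *\<^sub>R e) (c *\<^sub>R ?e')"
    using e by (auto simp: related_def q_simps scaleR_dual.rep_eq right_diff_distrib[symmetric])
  then show "phi A q q' F (c *\<^sub>R e) = c *\<^sub>R ?e'" by (rule phi_eqI)
qed

text \<open>Evaluate the relation for \<open>e\<close> at the lift of \<open>f\<close> and the
  relation for \<open>f\<close> at the lift of \<open>e\<close>. In the sum the two values of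
  \<open>F\<close> cancel.\<close>

lemma canonical_form_phi:
  "canonical_form (phi A q q' F e) (phi A q q' F f) = canonical_form e f"
proof -
  note e = related_phi[of e] and f = related_phi[of f]
  let ?u = "(fst e, fst (phi A q q' F e))" and ?v = "(fst f, fst (phi A q q' F f))"
  have uv: "?u \<in> C" "?v \<in> C" using related_lift(1) e f by blast+
  have "ev (snd e) (fst f) - F ?u ?v = ev (snd (phi A q q' F e)) (fst (phi A q q' F f))"
    "ev (snd f) (fst e) - F ?v ?u = ev (snd (phi A q q' F f)) (fst (phi A q q' F e))"
    using e f uv by (auto simp: related_def)
  then show ?thesis
    using F_skew[OF uv] by (simp add: canonical_form_def case_prod_beta)
qed

text \<open>Solving the relation for \<open>ev (snd e) (fst w)\<close> moves \<open>F\<close> to the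
  other side. Hence the minus sign, with which the relation of the swapped data is the converse of
  \<open>related\<close>.\<close>

lemma fibre_pairing_swap:
  "fibre_pairing A' q' A q (\<lambda>u v. - F (prod.swap u) (prod.swap v))"
proof (rule fibre_pairing.intro)
  have swap_C: "prod.swap u \<in> C" if "u \<in> fibre_product q' q" for u
    using that by (auto simp: fibre_product_def)
  show "two_form_on (fibre_product q' q) (\<lambda>u v. - F (prod.swap u) (prod.swap v))"
    unfolding two_form_on_def linear_form_on_def
    using swap_C F_self F_add F_add_right F_scale F_scale_right
    by (auto simp: prod.swap_def)
  show "nondegenerate_in_fibres A' A (\<lambda>u v. - F (prod.swap u) (prod.swap v))"
    using nondeg F_skew[OF fibre_in_C fibre'_in_C]
    by (auto simp: nondegenerate_in_fibres_def)
qed (fact fin fin' q q')+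

text \<open>Uniqueness for the swapped relation is injectivity of \<open>phi\<close>, and existence
  for it is surjectivity.\<close>

lemma bij_phi: "bij (phi A q q' F)"
proof (rule bijI)
  interpret swap: fibre_pairing A' q' A q "\<lambda>u v. - F (prod.swap u) (prod.swap v)"
    by (rule fibre_pairing_swap)
  have swap_related: "swap.related e' e \<longleftrightarrow> related e e'" for e e'
    by (auto simp: related_def swap.related_def fibre_product_def algebra_simps; metis)
  show "inj (phi A q q' F)"
    by (rule injI) (metis related_phi swap.related_unique swap_related)
  show "surj (phi A q q' F)"
    unfolding surj_def by (metis phi_eqI swap.related_ex swap_related)
qed

end

section \<open>Compatibility with the Courant brackets\<close>

lemma fst_courant: "fst (courant br H e f) = br (fst e) (fst f)"
  by (simp add: courant_def case_prod_beta)

text \<open>\<open>ev\<close> undoes \<open>Abs_dual\<close> once the functional is known to be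
  linear. The sign in \<open>ce_d1\<close> makes the \<open>snd e\<close> term positive and the
  \<open>snd f\<close> term negative.\<close>

lemma ev_snd_courant:
  assumes br: "bilinear br" and H: "three_form H"
  shows "ev (snd (courant br H e f)) z
    = ev (snd e) (br (fst f) z) - ev (snd f) (br (fst e) z) + H (fst f) (fst e) z"
proof -
  have br_lin: "linear (\<lambda>z. br x z)" for x
    using br by (simp add: bilinear_def)
  have H_lin: "linear (\<lambda>z. H x y z)" for x y
    using H by (simp add: three_form_def)
  have "linear (\<lambda>z. ce_d1 br (ev (snd f)) (fst e) z - ce_d1 br (ev (snd e)) (fst f) z
      + H (fst f) (fst e) z)"
    by (rule linearI) (simp_all add: ce_d1_def linear_add[OF br_lin] linear_scale[OF br_lin]
        linear_add[OF H_lin] linear_scale[OF H_lin] linear_add[OF linear_ev]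
        linear_scale[OF linear_ev] algebra_simps)
  then show ?thesis
    by (simp add: courant_def case_prod_beta ev_Abs_dual) (simp add: ce_d1_def)
qed

lemma bilinear_skew:
  assumes "bilinear B" and "\<And>x. B x x = 0"
  shows "B y x = - B x y"
proof -
  have "B x x + B y x + (B x y + B y y) = 0"
    using assms(2)[of "x + y"]
    by (simp only: bilinear_ladd[OF assms(1)] bilinear_radd[OF assms(1)])
  then show ?thesis by (simp add: assms(2) eq_neg_iff_add_eq_0)
qed

text \<open>Of the three terms of \<open>dF\<close> at \<open>v\<close>, \<open>u\<close>,
  \<open>w\<close>, two cancel the values of \<open>F\<close> that arise from the relations for
  \<open>e\<close> and \<open>f\<close> at bracketed arguments. The third is the value of
  \<open>F\<close> at the bracket of \<open>u\<close> and \<open>v\<close> that the new relation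
  demands.\<close>

lemma (in fibre_pairing) phi_courant:
  assumes br: "bilinear br" "\<And>x. br x x = 0" and H: "three_form H"
    and br': "bilinear br'" "\<And>x. br' x x = 0" and H': "three_form H'"
    and hom: "\<And>x y. q (br x y) = brn (q x) (q y)" "\<And>x y. q' (br' x y) = brn (q' x) (q' y)"
    and dF: "\<And>u v w. u \<in> C \<Longrightarrow> v \<in> C \<Longrightarrow> w \<in> C \<Longrightarrow>
      H (fst u) (fst v) (fst w) - H' (snd u) (snd v) (snd w) = ce_d2 (sum_bracket br br') F u v w"
  shows "phi A q q' F (courant br H e f)
    = courant br' H' (phi A q q' F e) (phi A q q' F f)"
proof (rule phi_eqI)
  define e' where "e' = phi A q q' F e"
  define f' where "f' = phi A q q' F f"
  have rel: "related e e'" "related f f'" unfolding e'_def f'_def by (rule related_phi)+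
  define u where "u = (fst e, fst e')"
  define v where "v = (fst f, fst f')"
  let ?b = "sum_bracket br br'"
  have uv: "u \<in> C" "v \<in> C" unfolding u_def v_def using related_lift(1) rel by blast+
  \<comment> \<open>Both quotient maps are homomorphisms to the same bracket \<open>brn\<close>, so
    \<open>C\<close> is a subalgebra and the relations may be evaluated at brackets.\<close>
  have b_C: "?b x y \<in> C" if "x \<in> C" "y \<in> C" for x y
    using that by (simp add: C_iff sum_bracket_def case_prod_beta hom)
  have b_skew: "?b v u = - 1 *\<^sub>R ?b u v"
    using bilinear_skew[OF br, where x = "fst u" and y = "fst v"]
      bilinear_skew[OF br', where x = "snd u" and y = "snd v"]
    by (simp add: sum_bracket_def case_prod_beta)
  show "related (courant br H e f) (courant br' H' (phi A q q' F e) (phi A q q' F f))"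
    unfolding related_def e'_def[symmetric] f'_def[symmetric]
  proof (intro conjI ballI)
    show "q (fst (courant br H e f)) = q' (fst (courant br' H' e' f'))"
      using uv by (simp add: fst_courant hom C_iff u_def v_def)
    fix w assume w: "w \<in> C"
    have E: "ev (snd e) (br (fst f) (fst w)) - F u (?b v w) = ev (snd e') (br' (fst f') (snd w))"
      and G: "ev (snd f) (br (fst e) (fst w)) - F v (?b u w) = ev (snd f') (br' (fst e') (snd w))"
      using rel b_C[OF uv(2) w] b_C[OF uv(1) w]
      by (auto simp: related_def u_def v_def sum_bracket_def case_prod_beta)
    \<comment> \<open>The order \<open>v\<close>, \<open>u\<close> matches the twist in the Courant
      bracket, where the second argument enters \<open>H\<close> first.\<close>
    have "H (fst f) (fst e) (fst w) - H' (fst f') (fst e') (snd w)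
        = - F (?b v u) w + F (?b v w) u - F (?b u w) v"
      using dF[OF uv(2,1) w] by (simp add: u_def v_def ce_d2_def)
    also have "\<dots> = F (?b u v) w - F u (?b v w) + F v (?b u w)"
      unfolding b_skew using F_scale[OF b_C[OF uv] w, of "- 1"] F_skew[OF b_C[OF uv(2) w] uv(1)]
        F_skew[OF b_C[OF uv(1) w] uv(2)] by simp
    moreover have "(fst (courant br H e f), fst (courant br' H' e' f')) = ?b u v"
      by (simp add: fst_courant u_def v_def sum_bracket_def)
    ultimately show "ev (snd (courant br H e f)) (fst w)
        - F (fst (courant br H e f), fst (courant br' H' e' f')) w
        = ev (snd (courant br' H' e' f')) (snd w)"
      using E G by (simp add: ev_snd_courant[OF br(1) H] ev_snd_courant[OF br'(1) H'])
  qed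
qed

section \<open>Transport of generalized complex structures\<close>

lemma cmap_cbilin:
  assumes "linear \<psi>" and "\<And>e f. \<psi> (B e f) = B' (\<psi> e) (\<psi> f)"
  shows "cmap \<psi> (cbilin B u v) = cbilin B' (cmap \<psi> u) (cmap \<psi> v)"
  by (simp add: cmap_def cbilin_def case_prod_beta linear_add[OF assms(1)]
      linear_diff[OF assms(1)] assms(2))

lemma i_eigenspace_iff: "u \<in> i_eigenspace J \<longleftrightarrow> J (fst u) = - snd u \<and> J (snd u) = fst u"
  by (simp add: i_eigenspace_def cmap_def cscale_def case_prod_beta prod_eq_iff)

text \<open>For involutivity, two elements of the new eigenspace are pulled back along the
  complexified \<open>\<psi>\<close>, bracketed in the eigenspace of \<open>J\<close>, and pushed
  forward again.\<close>

lemma generalized_complex_structure_transport: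
  assumes \<psi>: "linear \<psi>" "bij \<psi>"
    and form: "\<And>e f. canonical_form (\<psi> e) (\<psi> f) = canonical_form e f"
    and bracket: "\<And>e f. \<psi> (courant br H e f) = courant br' H' (\<psi> e) (\<psi> f)"
    and J: "generalized_complex_structure br H J"
  shows "generalized_complex_structure br' H' (\<psi> \<circ> J \<circ> inv \<psi>)"
proof -
  let ?K = "\<psi> \<circ> J \<circ> inv \<psi>"
  have inv_\<psi> [simp]: "inv \<psi> (\<psi> e) = e" "\<psi> (inv \<psi> e') = e'" for e e'
    using \<psi>(2) by (simp_all add: bij_is_inj bij_is_surj surj_f_inv_f)
  have lin_inv: "linear (inv \<psi>)"
    by (rule linearI; rule injD[OF bij_is_inj[OF \<psi>(2)]])
      (simp_all add: linear_add[OF \<psi>(1)] linear_scale[OF \<psi>(1)])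
  have J_lin: "linear J" and J_sq: "\<And>e. J (J e) = - e"
    and J_form: "\<And>e f. canonical_form (J e) (J f) = canonical_form e f"
    and J_inv: "\<And>u v. u \<in> i_eigenspace J \<Longrightarrow> v \<in> i_eigenspace J
      \<Longrightarrow> cbilin (courant br H) u v \<in> i_eigenspace J"
    using J by (auto simp: generalized_complex_structure_def)
  have form_inv: "canonical_form (inv \<psi> e') (inv \<psi> f') = canonical_form e' f'" for e' f'
    using form[of "inv \<psi> e'" "inv \<psi> f'"] by simp
  have eig: "cmap \<psi> u \<in> i_eigenspace ?K" if "u \<in> i_eigenspace J" for u
    using that by (simp add: i_eigenspace_iff cmap_def case_prod_beta linear_neg[OF \<psi>(1)])
  have eig_inv: "cmap (inv \<psi>) u \<in> i_eigenspace J" if "u \<in> i_eigenspace ?K" for u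
  proof -
    have "inv \<psi> (?K (fst u)) = - inv \<psi> (snd u)" "inv \<psi> (?K (snd u)) = inv \<psi> (fst u)"
      using that by (simp_all add: i_eigenspace_iff linear_neg[OF lin_inv])
    then show ?thesis by (simp add: i_eigenspace_iff cmap_def case_prod_beta)
  qed
  have "cbilin (courant br' H') u v \<in> i_eigenspace ?K"
    if "u \<in> i_eigenspace ?K" "v \<in> i_eigenspace ?K" for u v
  proof -
    have "cmap \<psi> (cmap (inv \<psi>) w) = w" for w
      by (simp add: cmap_def case_prod_beta)
    moreover have "cmap \<psi> (cbilin (courant br H) (cmap (inv \<psi>) u) (cmap (inv \<psi>) v))
        \<in> i_eigenspace ?K"
      by (rule eig[OF J_inv[OF eig_inv[OF that(1)] eig_inv[OF that(2)]]])
    ultimately show ?thesis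
      by (simp add: cmap_cbilin[where B = "courant br H" and B' = "courant br' H'",
            OF \<psi>(1) bracket])
  qed
  moreover have "linear ?K"
    by (rule linear_compose[OF lin_inv linear_compose[OF J_lin \<psi>(1)]])
  ultimately show ?thesis
    by (simp add: generalized_complex_structure_def form J_form form_inv J_sq linear_neg[OF \<psi>(1)])
qed

section \<open>Generalized complex structures on dual triples\<close>

theorem corollary3p9:
  fixes br :: "'g::real_vector \<Rightarrow> 'g \<Rightarrow> 'g" and A :: "'g set" and H :: "'g \<Rightarrow> 'g \<Rightarrow> 'g \<Rightarrow> real"
    and br' :: "'h::real_vector \<Rightarrow> 'h \<Rightarrow> 'h" and A' :: "'h set" and H' :: "'h \<Rightarrow> 'h \<Rightarrow> 'h \<Rightarrow> real"
    and brn :: "'n::real_vector \<Rightarrow> 'n \<Rightarrow> 'n" and q :: "'g \<Rightarrow> 'n" and q' :: "'h \<Rightarrow> 'n"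
    and F :: "'g \<times> 'h \<Rightarrow> 'g \<times> 'h \<Rightarrow> real"
    and J :: "'g \<times> 'g dual \<Rightarrow> 'g \<times> 'g dual"
  assumes "admissible br A H" and "admissible br' A' H'"
    and "lie_algebra brn" and "lie_quotient_map br A brn q" and "lie_quotient_map br' A' brn q'"
    and "duality_form br A H q br' A' H' q' F"
    and "generalized_complex_structure br H J"
  shows "generalized_complex_structure br' H' (phi A q q' F \<circ> J \<circ> inv (phi A q q' F))"
proof -
  have lie: "lie_algebra br" "lie_algebra br'"
    and H: "three_form H" and H': "three_form H'"
    using assms(1,2) by (simp_all add: admissible_def closed_three_form_def)
  have quot: "linear q" "surj q" "{x. q x = 0} = A" "\<And>x y. q (br x y) = brn (q x) (q y)"
    using assms(4) by (simp_all add: lie_quotient_map_def)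
  have quot': "linear q'" "surj q'" "{x. q' x = 0} = A'"
    "\<And>x y. q' (br' x y) = brn (q' x) (q' y)"
    using assms(5) by (simp_all add: lie_quotient_map_def)
  note duality = assms(6)[unfolded duality_form_def]
  interpret fibre_pairing A q A' q' F
    by (rule fibre_pairing.intro[OF _ _ quot(1-3) quot'(1-3)])
      (use lie duality in \<open>simp_all add: lie_algebra_def\<close>)
  have br: "bilinear br" "\<And>x. br x x = 0" and br': "bilinear br'" "\<And>x. br' x x = 0"
    using lie by (simp_all add: lie_algebra_def)
  have dF: "H (fst u) (fst v) (fst w) - H' (snd u) (snd v) (snd w)
      = ce_d2 (sum_bracket br br') F u v w" if "u \<in> C" "v \<in> C" "w \<in> C" for u v w
    using duality that by blast
  have "phi A q q' F (courant br H e f) = courant br' H' (phi A q q' F e) (phi A q q' F f)" for e f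
    by (rule phi_courant[OF br H br' H' quot(4) quot'(4) dF])
  then show ?thesis
    by (rule generalized_complex_structure_transport
        [OF linear_phi bij_phi canonical_form_phi _ assms(7)])
qed

end
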